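(* Let $t=[p_1,p_2,p_3,p_4]\in L^4$ be a legitimate quadruple and let $l\in L$ be such that either $l=0$ or $l\in L^*\setminus(L^* )^{\sigma-1}$. Then $B(2,m,s,l,t)$ is a presemifield of order $2^{2m}$.
   Context: A (finite) presemifield is a finite additive abelian group with a multiplication that is distributive on both sides over addition and has no zero divisors. Let $m\ge 1$, $F=GF(2^{2m})\supset L=GF(2^m)$, $0\le s<2m$ an integer, $\sigma=2^s$ (so $u^\sigma=u^{2^s}$), and $(L^* )^{\sigma-1}=\{u^{\sigma-1}: u\in L^*\}$. Fix $\mu\in L$ of absolute trace $1$ and $z\in F$ with $z^2+z=\mu$; then $1,z$ is a basis of $F$ over $L$ and we write $(a,b)=a+bz$ for $a,b\in L$. A quadruple $t=[p_1,p_2,p_3,p_4]\in L^4$ is legitimate if the polynomial $p_{s,t}(X)=p_1X^{\sigma+1}+p_2X^{\sigma}+p_3X+p_4$ has no roots in $L$. $B(2,m,s,l,t)$ denotes the additive group of $F$ with the multiplication given, for $x=(a,b)$, $y=(c,d)$, by $$x\circ y=(p_1ac^{\sigma}+lp_1a^{\sigma}c+p_2bc^{\sigma}+lp_2a^{\sigma}d+p_3ad^{\sigma}+lp_3b^{\sigma}c+p_4bd^{\sigma}+lp_4b^{\sigma}d,\ ad+bc).$$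
   Formalization: The formal statement additionally assumes p_1 ≠ 0; without it the claim fails, e.g. t=[0,0,0,1] is legitimate but (1,0)∘(1,0)=0, and whenever p_1=0 the product has zero divisors. *)

theory Defs
  imports "HOL-Algebra.Algebra"
begin

text \<open>
  The record field \<open>one\<close> of \<open>R\<close> is unconstrained: a presemifield need not have an identity.
\<close>

locale presemifield = abelian_group R for R (structure) +
  assumes finite_carrier: "finite (carrier R)"
    and mult_closed: "\<lbrakk>x \<in> carrier R; y \<in> carrier R\<rbrakk> \<Longrightarrow> x \<otimes> y \<in> carrier R"
    and mult_distr_right:
      "\<lbrakk>x \<in> carrier R; y \<in> carrier R; w \<in> carrier R\<rbrakk> \<Longrightarrow> (x \<oplus> y) \<otimes> w = x \<otimes> w \<oplus> y \<otimes> w"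
    and mult_distr_left:
      "\<lbrakk>x \<in> carrier R; y \<in> carrier R; w \<in> carrier R\<rbrakk> \<Longrightarrow> w \<otimes> (x \<oplus> y) = w \<otimes> x \<oplus> w \<otimes> y"
    and no_zero_divisors:
      "\<lbrakk>x \<in> carrier R; y \<in> carrier R; x \<otimes> y = \<zero>\<rbrakk> \<Longrightarrow> x = \<zero> \<or> y = \<zero>"

text \<open>The absolute trace of \<open>GF(2^m)\<close>, computed in an extension field \<open>F\<close>.\<close>

definition abs_trace :: "('a, 'b) ring_scheme \<Rightarrow> nat \<Rightarrow> 'a \<Rightarrow> 'a" where
  "abs_trace F m x = (\<Oplus>\<^bsub>F\<^esub>i\<in>{..<m}. x [^]\<^bsub>F\<^esub> ((2::nat) ^ i))"

definition nonzero_powers :: "('a, 'b) ring_scheme \<Rightarrow> 'a set \<Rightarrow> nat \<Rightarrow> 'a set" where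
  "nonzero_powers F L k = {u [^]\<^bsub>F\<^esub> k |u. u \<in> L - {\<zero>\<^bsub>F\<^esub>}}"

definition eval_p ::
    "('a, 'b) ring_scheme \<Rightarrow> nat \<Rightarrow> 'a \<times> 'a \<times> 'a \<times> 'a \<Rightarrow> 'a \<Rightarrow> 'a" where
  "eval_p F s t x = (case t of (p1, p2, p3, p4) \<Rightarrow>
     p1 \<otimes>\<^bsub>F\<^esub> x [^]\<^bsub>F\<^esub> ((2::nat) ^ s + 1) \<oplus>\<^bsub>F\<^esub> p2 \<otimes>\<^bsub>F\<^esub> x [^]\<^bsub>F\<^esub> ((2::nat) ^ s)
       \<oplus>\<^bsub>F\<^esub> p3 \<otimes>\<^bsub>F\<^esub> x \<oplus>\<^bsub>F\<^esub> p4)"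

text \<open>
  Only roots in \<open>L\<close> itself are excluded here, not the point at infinity of the projective line
  (a root there means \<open>p1 = \<zero>\<close>). For \<open>p1 = \<zero>\<close> the product below has zero divisors, since all
  products \<open>(a,0) \<circ> (c,0) = (p1 a c^\<sigma> + l p1 a^\<sigma> c, 0)\<close> vanish, although
  for instance \<open>(\<zero>, \<zero>, \<zero>, \<one>)\<close> is legitimate. So \<open>p1 \<noteq> \<zero>\<close>, that is, \<open>p\<close> having degree
  \<open>\<sigma> + 1\<close>, has to be required separately.
\<close>

definition legitimate ::
    "('a, 'b) ring_scheme \<Rightarrow> 'a set \<Rightarrow> nat \<Rightarrow> 'a \<times> 'a \<times> 'a \<times> 'a \<Rightarrow> bool" where
  "legitimate F L s t \<longleftrightarrow> t \<in> L \<times> L \<times> L \<times> L \<and> (\<forall>x\<in>L. eval_p F s t x \<noteq> \<zero>\<^bsub>F\<^esub>)"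

definition from_coords :: "('a, 'b) ring_scheme \<Rightarrow> 'a \<Rightarrow> 'a \<times> 'a \<Rightarrow> 'a" where
  "from_coords F z v = fst v \<oplus>\<^bsub>F\<^esub> snd v \<otimes>\<^bsub>F\<^esub> z"

text \<open>Meaningful when \<open>\<one>, z\<close> is a basis of \<open>F\<close> over \<open>L\<close>.\<close>

definition coords :: "('a, 'b) ring_scheme \<Rightarrow> 'a set \<Rightarrow> 'a \<Rightarrow> 'a \<Rightarrow> 'a \<times> 'a" where
  "coords F L z x = (THE v. v \<in> L \<times> L \<and> from_coords F z v = x)"

definition B_mult ::
    "('a, 'b) ring_scheme \<Rightarrow> 'a set \<Rightarrow> 'a \<Rightarrow> nat \<Rightarrow> 'a \<Rightarrow> 'a \<times> 'a \<times> 'a \<times> 'a \<Rightarrow> 'a \<Rightarrow> 'a \<Rightarrow> 'a" where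
  "B_mult F L z s l t x y =
    (let (p1, p2, p3, p4) = t; (a, b) = coords F L z x; (c, d) = coords F L z y;
         fr = (\<lambda>u. u [^]\<^bsub>F\<^esub> ((2::nat) ^ s))
     in from_coords F z
       (p1 \<otimes>\<^bsub>F\<^esub> a \<otimes>\<^bsub>F\<^esub> fr c \<oplus>\<^bsub>F\<^esub> l \<otimes>\<^bsub>F\<^esub> p1 \<otimes>\<^bsub>F\<^esub> fr a \<otimes>\<^bsub>F\<^esub> c
        \<oplus>\<^bsub>F\<^esub> p2 \<otimes>\<^bsub>F\<^esub> b \<otimes>\<^bsub>F\<^esub> fr c \<oplus>\<^bsub>F\<^esub> l \<otimes>\<^bsub>F\<^esub> p2 \<otimes>\<^bsub>F\<^esub> fr a \<otimes>\<^bsub>F\<^esub> d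
        \<oplus>\<^bsub>F\<^esub> p3 \<otimes>\<^bsub>F\<^esub> a \<otimes>\<^bsub>F\<^esub> fr d \<oplus>\<^bsub>F\<^esub> l \<otimes>\<^bsub>F\<^esub> p3 \<otimes>\<^bsub>F\<^esub> fr b \<otimes>\<^bsub>F\<^esub> c
        \<oplus>\<^bsub>F\<^esub> p4 \<otimes>\<^bsub>F\<^esub> b \<otimes>\<^bsub>F\<^esub> fr d \<oplus>\<^bsub>F\<^esub> l \<otimes>\<^bsub>F\<^esub> p4 \<otimes>\<^bsub>F\<^esub> fr b \<otimes>\<^bsub>F\<^esub> d,
        a \<otimes>\<^bsub>F\<^esub> d \<oplus>\<^bsub>F\<^esub> b \<otimes>\<^bsub>F\<^esub> c))"

text \<open>
  The structure \<open>B(2,m,s,l,t)\<close>; the parameter \<open>m\<close> is determined by \<open>order F = 2^(2m)\<close>.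
\<close>

definition B2 ::
    "('a, 'b) ring_scheme \<Rightarrow> 'a set \<Rightarrow> 'a \<Rightarrow> nat \<Rightarrow> 'a \<Rightarrow> 'a \<times> 'a \<times> 'a \<times> 'a \<Rightarrow> ('a, 'b) ring_scheme" where
  "B2 F L z s l t = F\<lparr>mult := B_mult F L z s l t\<rparr>"

end

theory Submission
  imports Defs
begin

text \<open>
  If \<open>x \<circ> y = 0\<close>, the second coordinate says that \<open>(a,b)\<close> and \<open>(c,d)\<close> are proportional over \<open>L\<close>,
  say \<open>(a,b) = \<alpha>(e,f)\<close> and \<open>(c,d) = \<gamma>(e,f)\<close>. The first coordinate then factors as
  \<open>(\<alpha>\<gamma>\<^sup>\<sigma> + l\<alpha>\<^sup>\<sigma>\<gamma>)\<close> times the homogenisation of \<open>p\<close> at \<open>(e,f)\<close>. The second factor does not vanish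
  because \<open>p\<close> has no root on the projective line over \<open>L\<close>; the first vanishes only if
  \<open>l = (\<gamma>/\<alpha>)\<^sup>\<sigma>\<^sup>-\<^sup>1\<close>. The elements \<open>1, z\<close> form a basis because the trace of \<open>z\<^sup>2 + z\<close> telescopes to
  \<open>z^(2^m) + z\<close>, which would be \<open>0\<close> for \<open>z \<in> L\<close>.
\<close>

section \<open>Powers in finite subfields, and the characteristic\<close>

lemma (in monoid) submonoid_nat_pow_closed:
  assumes "submonoid H G" "x \<in> H"
  shows "x [^] (n::nat) \<in> H"
  using assms by (induction n) (auto intro: submonoid.m_closed submonoid.one_closed)

text \<open>The nonzero elements of \<open>K\<close> form a group of order
  \<open>card K - 1\<close>, so Lagrange's theorem gives \<open>x [^] (card K - 1) = \<one>\<close>,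
  and one more factor \<open>x\<close> finishes. Zero lies outside that group and only needs a
  positive exponent.\<close>

lemma (in field) subfield_pow_card:
  assumes "subfield K R" "finite K" "x \<in> K"
  shows "x [^] card K = x"
proof (cases "x = \<zero>")
  case True
  have "card K \<noteq> 0" using assms by auto
  then show ?thesis using True by (simp add: nat_pow_zero)
next
  case False
  let ?K = "R\<lparr>carrier := K\<rparr>"
  have fld: "field ?K" using subfield_iff(2)[OF assms(1)] .
  have fin: "finite (carrier ?K)" using assms(2) by simp
  have "x [^]\<^bsub>Multiplicative_Group.mult_of ?K\<^esub> order (Multiplicative_Group.mult_of ?K) = \<one>\<^bsub>Multiplicative_Group.mult_of ?K\<^esub>"
    using False assms(3) fin by (intro group.pow_order_eq_1 field.field_mult_group fld) auto
  moreover have "order (Multiplicative_Group.mult_of ?K) = card K - 1"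
    using field.order_mult_of[OF fld fin] by (simp add: order_def)
  ultimately have "x [^] (card K - 1) = \<one>"
    by (simp add: Multiplicative_Group.nat_pow_mult_of nat_pow_consistent[symmetric])
  moreover have "Suc (card K - 1) = card K"
    using assms by (metis Suc_pred' card_gt_0_iff empty_iff)
  moreover have "x \<in> carrier R" using assms subfieldE(3) by blast
  ultimately show ?thesis using nat_pow_Suc[of x "card K - 1"] by simp
qed

text \<open>Lagrange's theorem in the additive group kills the \<open>2 ^ k\<close>-fold multiple of
  \<open>\<one>\<close>. That multiple equals \<open>(\<one> \<oplus> \<one>) [^] k\<close>, and a
  field has no nilpotent elements besides zero.\<close>

lemma (in field) char_two_if_order:
  assumes "order R = 2 ^ k"
  shows "\<one> \<oplus> \<one> = \<zero>"
proof -
  have pow: "add_pow R ((2::nat) ^ n) \<one> = (\<one> \<oplus> \<one>) [^] n" for n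
  proof (induction n)
    case (Suc n)
    have "add_pow R ((2::nat) ^ Suc n) \<one> = add_pow R ((2::nat) ^ n) \<one> \<oplus> add_pow R ((2::nat) ^ n) \<one>"
      by (simp add: add.nat_pow_mult mult_2)
    also have "\<dots> = (\<one> \<oplus> \<one>) [^] n \<otimes> (\<one> \<oplus> \<one>)"
      by (simp add: Suc r_distr)
    finally show ?case by simp
  qed simp
  have "add_pow R (order R) \<one> = \<zero>"
    using group.pow_order_eq_1[OF add.is_group, of \<one>]
    by (simp add: add_pow_def order_def)
  then have "(\<one> \<oplus> \<one>) [^] k = \<zero>"
    using pow assms by simp
  \<comment> \<open>For \<open>k = 0\<close> the equation reads \<open>\<one> = \<zero>\<close>,
    which is impossible in a field.\<close>
  then show ?thesis
    by (induction k) (auto simp: integral_iff)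
qed

section \<open>Frobenius map and absolute trace in characteristic two\<close>

locale char_two_field = field +
  assumes char_two: "\<one> \<oplus> \<one> = \<zero>"
begin

lemma add_self: "x \<in> carrier R \<Longrightarrow> x \<oplus> x = \<zero>"
  by (metis char_two l_distr l_null l_one one_closed)

lemma eq_if_add_eq_zero:
  assumes "x \<in> carrier R" "y \<in> carrier R" "x \<oplus> y = \<zero>"
  shows "x = y"
  by (metis assms add_self add.inv_unique' minus_equality minus_minus)

text \<open>Squaring is additive because the two equal cross terms cancel, and the power
  \<open>2 ^ n\<close> is an \<open>n\<close>-fold squaring. Both distributive laws of the new
  product rest on this.\<close>

lemma frobenius_add:
  assumes "x \<in> carrier R" "y \<in> carrier R"
  shows "(x \<oplus> y) [^] ((2::nat) ^ n) = x [^] ((2::nat) ^ n) \<oplus> y [^] ((2::nat) ^ n)"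
proof (induction n)
  case (Suc n)
  have sq: "u [^] ((2::nat) ^ Suc n) = u [^] ((2::nat) ^ n) \<otimes> u [^] ((2::nat) ^ n)"
    if "u \<in> carrier R" for u
    using that by (simp add: nat_pow_mult mult_2)
  let ?u = "x [^] ((2::nat) ^ n)" and ?v = "y [^] ((2::nat) ^ n)"
  have uv: "?u \<in> carrier R" "?v \<in> carrier R" using assms by auto
  have "(?u \<oplus> ?v) \<otimes> (?u \<oplus> ?v) = ?u \<otimes> ?u \<oplus> ?v \<otimes> ?v \<oplus> (?u \<otimes> ?v \<oplus> ?u \<otimes> ?v)"
    using uv by algebra
  also have "\<dots> = ?u \<otimes> ?u \<oplus> ?v \<otimes> ?v"
    using uv by (simp add: add_self)
  finally show ?case using assms Suc by (simp only: sq add.m_closed)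
qed (use assms in auto)

lemma abs_trace_artin_schreier:
  assumes "x \<in> carrier R"
  shows "abs_trace R n (x [^] (2::nat) \<oplus> x) = x [^] ((2::nat) ^ n) \<oplus> x"
proof (induction n)
  case 0
  then show ?case using assms by (simp add: abs_trace_def add_self)
next
  case (Suc n)
  let ?q = "(2::nat) ^ n"
  have "abs_trace R (Suc n) (x [^] (2::nat) \<oplus> x)
      = (x [^] (2::nat) \<oplus> x) [^] ?q \<oplus> abs_trace R n (x [^] (2::nat) \<oplus> x)"
    using assms by (simp add: abs_trace_def lessThan_Suc)
  also have "\<dots> = (x [^] (2 * ?q) \<oplus> x [^] ?q) \<oplus> (x [^] ?q \<oplus> x)"
    using assms by (simp add: Suc frobenius_add nat_pow_pow)
  \<comment> \<open>The power \<open>x [^] ?q\<close> occurs both in the new summand and at the end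
    of the telescoped sum; bringing the two copies together lets them cancel.\<close>
  also have "\<dots> = x [^] (2 * ?q) \<oplus> x \<oplus> (x [^] ?q \<oplus> x [^] ?q)"
    using assms by (simp add: a_ac)
  also have "\<dots> = x [^] ((2::nat) ^ Suc n) \<oplus> x"
    using assms by (simp add: add_self)
  finally show ?case .
qed

lemma notin_subfield_if_abs_trace_one:
  assumes "subfield L R" "card L = 2 ^ m" "abs_trace R m (z [^] (2::nat) \<oplus> z) = \<one>"
  shows "z \<notin> L"
proof
  assume z: "z \<in> L"
  \<comment> \<open>An infinite set has \<open>card\<close> zero by convention, so a power of two as
    cardinality forces finiteness.\<close>
  have "finite L" using assms(2) by (metis card.infinite power_not_zero zero_neq_numeral)
  then have "z [^] ((2::nat) ^ m) = z"
    using subfield_pow_card[OF assms(1) _ z] assms(2) by simp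
  moreover have "z \<in> carrier R" using z assms(1) subfieldE(3) by blast
  ultimately show False
    using assms(3) by (simp add: abs_trace_artin_schreier add_self)
qed

end

section \<open>The basis \<open>\<one>, z\<close> of the field over \<open>L\<close>\<close>

lemma (in field) from_coords_eq_zero:
  assumes "subfield L R" "z \<in> carrier R" "z \<notin> L" "a \<in> L" "b \<in> L"
    and "from_coords R z (a, b) = \<zero>"
  shows "a = \<zero> \<and> b = \<zero>"
proof -
  note L = subringE[OF subfieldE(1)[OF assms(1)]]
  have car: "a \<in> carrier R" "b \<in> carrier R" using assms(4,5) L(1) by auto
  have eq: "a \<oplus> b \<otimes> z = \<zero>" using assms(6) by (simp add: from_coords_def)
  have "b = \<zero>"
  \<comment> \<open>Linear independence: a nonzero \<open>b\<close> could be divided out of the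
    relation, which would place \<open>z\<close> in \<open>L\<close>.\<close>
  proof (rule ccontr)
    assume "b \<noteq> \<zero>"
    have "b \<otimes> z = \<ominus> a"
      using eq car assms(2) by (metis add.inv_closed local.minus_equality a_comm m_closed minus_minus)
    then have "b \<otimes> z \<in> L" using L(5) assms(4) by simp
    then have "z \<in> L"
      using subfield_m_inv_simprule[OF assms(1)] \<open>b \<noteq> \<zero>\<close> assms by blast
    then show False using assms by simp
  qed
  then show ?thesis using eq car assms(2) by simp
qed

lemma (in field) inj_on_from_coords:
  assumes "subfield L R" "z \<in> carrier R" "z \<notin> L"
  shows "inj_on (from_coords R z) (L \<times> L)"
proof (rule inj_onI, clarify)
  fix a b c d
  assume ab: "a \<in> L" "b \<in> L" "c \<in> L" "d \<in> L"
    and eq: "from_coords R z (a, b) = from_coords R z (c, d)"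
  note L = subringE[OF subfieldE(1)[OF assms(1)]]
  have car: "a \<in> carrier R" "b \<in> carrier R" "c \<in> carrier R" "d \<in> carrier R"
    using ab L(1) by auto
  have "from_coords R z (a \<ominus> c, b \<ominus> d) = (a \<oplus> b \<otimes> z) \<ominus> (c \<oplus> d \<otimes> z)"
    unfolding from_coords_def fst_conv snd_conv using car assms(2) by algebra
  also have "\<dots> = \<zero>" using eq car assms(2) by (simp add: from_coords_def minus_eq r_neg)
  finally have "a \<ominus> c = \<zero> \<and> b \<ominus> d = \<zero>"
    using ab L(5,7) by (intro from_coords_eq_zero[OF assms]) (auto simp: minus_eq)
  then show "a = c \<and> b = d" using car by (simp add: r_right_minus_eq)
qed

text \<open>Spanning comes from counting: an injective map into a finite set with equally many
  elements is onto.\<close>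

lemma (in field) bij_betw_from_coords:
  assumes "subfield L R" "z \<in> carrier R" "z \<notin> L" "finite (carrier R)"
    and "order R = card L * card L"
  shows "bij_betw (from_coords R z) (L \<times> L) (carrier R)"
proof -
  have "from_coords R z ` (L \<times> L) \<subseteq> carrier R"
    using assms(2) subfieldE(3)[OF assms(1)] by (auto simp: from_coords_def subset_iff)
  moreover have "card (from_coords R z ` (L \<times> L)) = card (carrier R)"
    using card_image[OF inj_on_from_coords[OF assms(1-3)]] assms(5)
    by (simp add: card_cartesian_product order_def)
  ultimately show ?thesis
    using inj_on_from_coords[OF assms(1-3)] card_subset_eq[OF assms(4)]
    unfolding bij_betw_def by blast
qed

section \<open>The product in coordinates\<close>

lemma coords_from_coords:
  assumes "inj_on (from_coords F z) (L \<times> L)" "a \<in> L" "b \<in> L"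
  shows "coords F L z (from_coords F z (a, b)) = (a, b)"
  unfolding coords_def
proof (rule the_equality)
  show "v = (a, b)" if "v \<in> L \<times> L \<and> from_coords F z v = from_coords F z (a, b)" for v
    using inj_onD[OF assms(1), of v "(a, b)"] that assms(2,3) by simp
qed (use assms(2,3) in simp)

text \<open>The first coordinate of the product as a function of four scalars, so that its
  additivity and its factorisation can be treated without reference to
  \<open>coords\<close>.\<close>

definition B_fst ::
    "('a, 'b) ring_scheme \<Rightarrow> nat \<Rightarrow> 'a \<Rightarrow> 'a \<times> 'a \<times> 'a \<times> 'a \<Rightarrow> 'a \<Rightarrow> 'a \<Rightarrow> 'a \<Rightarrow> 'a \<Rightarrow> 'a" where
  "B_fst F s l t a b c d =
    (let (p1, p2, p3, p4) = t; fr = (\<lambda>u. u [^]\<^bsub>F\<^esub> ((2::nat) ^ s))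
     in p1 \<otimes>\<^bsub>F\<^esub> a \<otimes>\<^bsub>F\<^esub> fr c \<oplus>\<^bsub>F\<^esub> l \<otimes>\<^bsub>F\<^esub> p1 \<otimes>\<^bsub>F\<^esub> fr a \<otimes>\<^bsub>F\<^esub> c
        \<oplus>\<^bsub>F\<^esub> p2 \<otimes>\<^bsub>F\<^esub> b \<otimes>\<^bsub>F\<^esub> fr c \<oplus>\<^bsub>F\<^esub> l \<otimes>\<^bsub>F\<^esub> p2 \<otimes>\<^bsub>F\<^esub> fr a \<otimes>\<^bsub>F\<^esub> d
        \<oplus>\<^bsub>F\<^esub> p3 \<otimes>\<^bsub>F\<^esub> a \<otimes>\<^bsub>F\<^esub> fr d \<oplus>\<^bsub>F\<^esub> l \<otimes>\<^bsub>F\<^esub> p3 \<otimes>\<^bsub>F\<^esub> fr b \<otimes>\<^bsub>F\<^esub> c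
        \<oplus>\<^bsub>F\<^esub> p4 \<otimes>\<^bsub>F\<^esub> b \<otimes>\<^bsub>F\<^esub> fr d \<oplus>\<^bsub>F\<^esub> l \<otimes>\<^bsub>F\<^esub> p4 \<otimes>\<^bsub>F\<^esub> fr b \<otimes>\<^bsub>F\<^esub> d)"

text \<open>Once every field element is written as \<open>from_coords F z (a, b)\<close>, this rule
  removes the definite description in \<open>coords\<close> from all later arguments.\<close>

lemma B_mult_from_coords:
  assumes "inj_on (from_coords F z) (L \<times> L)" "a \<in> L" "b \<in> L" "c \<in> L" "d \<in> L"
  shows "B_mult F L z s l t (from_coords F z (a, b)) (from_coords F z (c, d)) =
    from_coords F z (B_fst F s l t a b c d, a \<otimes>\<^bsub>F\<^esub> d \<oplus>\<^bsub>F\<^esub> b \<otimes>\<^bsub>F\<^esub> c)"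
  using assms by (simp add: B_mult_def B_fst_def coords_from_coords Let_def split: prod.split)

context field begin

lemma from_coords_add:
  assumes "z \<in> carrier R" "a \<in> carrier R" "b \<in> carrier R" "c \<in> carrier R" "d \<in> carrier R"
  shows "from_coords R z (a, b) \<oplus> from_coords R z (c, d) = from_coords R z (a \<oplus> c, b \<oplus> d)"
  unfolding from_coords_def fst_conv snd_conv using assms by algebra

lemma B_fst_in_subring:
  assumes "subring L R" "l \<in> L" "t \<in> L \<times> L \<times> L \<times> L" "a \<in> L" "b \<in> L" "c \<in> L" "d \<in> L"
  shows "B_fst R s l t a b c d \<in> L"
proof -
  note L = subringE(6,7)[OF assms(1)]
  have "u [^] (n::nat) \<in> L" if "u \<in> L" for u n
    using that subring.axioms(2)[OF assms(1)] by (rule submonoid_nat_pow_closed[rotated])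
  with assms show ?thesis
    by (cases t) (simp add: B_fst_def Let_def L)
qed

text \<open>For each coefficient \<open>p\<close> there is a plain term and an
  \<open>l\<close>-twisted one. In the twisted term the power moves to the other argument, while the
  basis coordinate being powered stays the same. On proportional arguments both therefore contain
  \<open>p \<otimes> g \<otimes> h [^] q\<close> with the same \<open>g\<close> and
  \<open>h\<close>, and all four pairs share one scalar factor. What remains is the homogenisation
  of \<open>p\<close> at \<open>(e, f)\<close>.\<close>

lemma B_fst_proportional:
  fixes s :: nat
  defines "q \<equiv> (2::nat) ^ s"
  assumes "l \<in> carrier R" "p1 \<in> carrier R" "p2 \<in> carrier R" "p3 \<in> carrier R" "p4 \<in> carrier R"
    and "\<alpha> \<in> carrier R" "\<gamma> \<in> carrier R" "e \<in> carrier R" "f \<in> carrier R"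
  shows "B_fst R s l (p1, p2, p3, p4) (\<alpha> \<otimes> e) (\<alpha> \<otimes> f) (\<gamma> \<otimes> e) (\<gamma> \<otimes> f) =
    (\<alpha> \<otimes> \<gamma> [^] q \<oplus> l \<otimes> \<alpha> [^] q \<otimes> \<gamma>) \<otimes>
    (p1 \<otimes> e \<otimes> e [^] q \<oplus> p2 \<otimes> f \<otimes> e [^] q \<oplus> p3 \<otimes> e \<otimes> f [^] q \<oplus> p4 \<otimes> f \<otimes> f [^] q)"
proof -
  define S where "S = \<alpha> \<otimes> \<gamma> [^] q \<oplus> l \<otimes> \<alpha> [^] q \<otimes> \<gamma>"
  have S: "S \<in> carrier R" using assms by (simp add: S_def)
  have pair: "p \<otimes> (\<alpha> \<otimes> g) \<otimes> (\<gamma> \<otimes> h) [^] q \<oplus> l \<otimes> p \<otimes> (\<alpha> \<otimes> h) [^] q \<otimes> (\<gamma> \<otimes> g)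
      = S \<otimes> (p \<otimes> g \<otimes> h [^] q)"
    if "p \<in> carrier R" "g \<in> carrier R" "h \<in> carrier R" for p g h
    using that assms(2-) by (simp add: S_def nat_pow_distrib l_distr r_distr m_ac)
  \<comment> \<open>Brackets the sum into a plain and a twisted term for each coefficient, so that
    \<open>pair\<close> applies.\<close>
  have assoc: "x1 \<oplus> y1 \<oplus> x2 \<oplus> y2 \<oplus> x3 \<oplus> y3 \<oplus> x4 \<oplus> y4
      = (x1 \<oplus> y1) \<oplus> (x2 \<oplus> y2) \<oplus> (x3 \<oplus> y3) \<oplus> (x4 \<oplus> y4)"
    if "x1 \<in> carrier R" "y1 \<in> carrier R" "x2 \<in> carrier R" "y2 \<in> carrier R"
      "x3 \<in> carrier R" "y3 \<in> carrier R" "x4 \<in> carrier R" "y4 \<in> carrier R"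
    for x1 y1 x2 y2 x3 y3 x4 y4
    using that by (simp add: a_assoc)
  show ?thesis
    unfolding S_def[symmetric] B_fst_def Let_def prod.case q_def[symmetric]
    using assms(2-) S by (subst assoc) (simp_all add: pair r_distr)
qed

end

section \<open>Additivity of the first coordinate in each argument\<close>

context char_two_field begin

text \<open>Distributing a sum of arguments splits each of the eight terms of \<open>B_fst\<close>
  in two. The sixteen summands then alternate between the two arguments and have to be
  sorted.\<close>

lemma sum_8_interchange:
  assumes "x1 \<in> carrier R" "y1 \<in> carrier R" "x2 \<in> carrier R" "y2 \<in> carrier R" "x3 \<in> carrier R" "y3 \<in> carrier R"
    and "x4 \<in> carrier R" "y4 \<in> carrier R" "x5 \<in> carrier R" "y5 \<in> carrier R" "x6 \<in> carrier R" "y6 \<in> carrier R"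
    and "x7 \<in> carrier R" "y7 \<in> carrier R" "x8 \<in> carrier R" "y8 \<in> carrier R"
  shows "(x1 \<oplus> y1) \<oplus> (x2 \<oplus> y2) \<oplus> (x3 \<oplus> y3) \<oplus> (x4 \<oplus> y4) \<oplus> (x5 \<oplus> y5) \<oplus> (x6 \<oplus> y6) \<oplus> (x7 \<oplus> y7) \<oplus> (x8 \<oplus> y8)
    = (x1 \<oplus> x2 \<oplus> x3 \<oplus> x4 \<oplus> x5 \<oplus> x6 \<oplus> x7 \<oplus> x8) \<oplus> (y1 \<oplus> y2 \<oplus> y3 \<oplus> y4 \<oplus> y5 \<oplus> y6 \<oplus> y7 \<oplus> y8)"
proof -
  have swap: "(x \<oplus> y) \<oplus> (u \<oplus> v) = (x \<oplus> u) \<oplus> (y \<oplus> v)"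
    if "x \<in> carrier R" "y \<in> carrier R" "u \<in> carrier R" "v \<in> carrier R" for x y u v
    using that by (simp add: a_ac)
  \<comment> \<open>Each instance of \<open>swap\<close> absorbs one further pair into the two
    partial sums.\<close>
  show ?thesis
    using assms by (simp add:
      swap[of "x1" "y1" x2 y2]
      swap[of "x1 \<oplus> x2" "y1 \<oplus> y2" x3 y3]
      swap[of "x1 \<oplus> x2 \<oplus> x3" "y1 \<oplus> y2 \<oplus> y3" x4 y4]
      swap[of "x1 \<oplus> x2 \<oplus> x3 \<oplus> x4" "y1 \<oplus> y2 \<oplus> y3 \<oplus> y4" x5 y5]
      swap[of "x1 \<oplus> x2 \<oplus> x3 \<oplus> x4 \<oplus> x5" "y1 \<oplus> y2 \<oplus> y3 \<oplus> y4 \<oplus> y5" x6 y6]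
      swap[of "x1 \<oplus> x2 \<oplus> x3 \<oplus> x4 \<oplus> x5 \<oplus> x6" "y1 \<oplus> y2 \<oplus> y3 \<oplus> y4 \<oplus> y5 \<oplus> y6" x7 y7]
      swap[of "x1 \<oplus> x2 \<oplus> x3 \<oplus> x4 \<oplus> x5 \<oplus> x6 \<oplus> x7" "y1 \<oplus> y2 \<oplus> y3 \<oplus> y4 \<oplus> y5 \<oplus> y6 \<oplus> y7" x8 y8])
qed

text \<open>Each of the eight terms contains exactly one coordinate of the left argument, either
  plain or under the Frobenius power, and is additive in it. The same holds for the right
  argument.\<close>

lemma B_fst_add_left:
  assumes "l \<in> carrier R" "t \<in> carrier R \<times> carrier R \<times> carrier R \<times> carrier R"
    and "a \<in> carrier R" "b \<in> carrier R" "a' \<in> carrier R" "b' \<in> carrier R"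
    and "c \<in> carrier R" "d \<in> carrier R"
  shows "B_fst R s l t (a \<oplus> a') (b \<oplus> b') c d = B_fst R s l t a b c d \<oplus> B_fst R s l t a' b' c d"
  using assms by (cases t) (simp add: B_fst_def Let_def frobenius_add l_distr r_distr, intro sum_8_interchange; simp)

lemma B_fst_add_right:
  assumes "l \<in> carrier R" "t \<in> carrier R \<times> carrier R \<times> carrier R \<times> carrier R"
    and "a \<in> carrier R" "b \<in> carrier R" "c \<in> carrier R" "d \<in> carrier R"
    and "c' \<in> carrier R" "d' \<in> carrier R"
  shows "B_fst R s l t a b (c \<oplus> c') (d \<oplus> d') = B_fst R s l t a b c d \<oplus> B_fst R s l t a b c' d'"
  using assms by (cases t) (simp add: B_fst_def Let_def frobenius_add l_distr r_distr, intro sum_8_interchange; simp)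

section \<open>Absence of zero divisors\<close>

lemma scalar_factor_nonzero:
  assumes L: "subfield L R" and "\<alpha> \<in> L - {\<zero>}" "\<gamma> \<in> L - {\<zero>}" "l \<in> L" "n > 0"
    and l: "l = \<zero> \<or> l \<notin> nonzero_powers R L (n - 1)"
  shows "\<alpha> \<otimes> \<gamma> [^] n \<oplus> l \<otimes> \<alpha> [^] n \<otimes> \<gamma> \<noteq> \<zero>"
proof
  assume eq: "\<alpha> \<otimes> \<gamma> [^] n \<oplus> l \<otimes> \<alpha> [^] n \<otimes> \<gamma> = \<zero>"
  note sub = subringE[OF subfieldE(1)[OF L]]
  have car: "\<alpha> \<in> carrier R" "\<gamma> \<in> carrier R" "l \<in> carrier R"
    using assms(2-4) sub(1) by auto
  have pow0: "u [^] (k::nat) \<noteq> \<zero>" if "u \<in> carrier R" "u \<noteq> \<zero>" for u k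
    using that by (induction k) (auto simp: integral_iff)
  show False
  proof (cases "l = \<zero>")
    case True
    then show False
      using eq car pow0[of \<gamma> n] assms(2,3) by (simp add: integral_iff)
  next
    case False
    define u where "u = \<gamma> \<otimes> inv \<alpha>"
    have inv: "inv \<alpha> \<in> L - {\<zero>}" "inv \<alpha> \<otimes> \<alpha> = \<one>"
      using subfield_m_inv[OF L assms(2)] by auto
    have invc: "inv \<alpha> \<in> carrier R" using inv sub(1) by auto
    have u: "u \<in> L - {\<zero>}" "u \<in> carrier R"
      using assms(3) inv sub(1,6) car invc by (auto simp: u_def integral_iff)
    have \<gamma>: "\<gamma> = u \<otimes> \<alpha>" using inv(2) car invc by (simp add: u_def m_assoc)
    \<comment> \<open>After substituting \<open>\<gamma> = u \<otimes> \<alpha>\<close>, both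
      \<open>\<alpha> \<otimes> \<gamma> [^] n\<close> and
      \<open>l \<otimes> \<alpha> [^] n \<otimes> \<gamma>\<close> are multiples of
      \<open>?w\<close>. Cancelling it leaves \<open>u [^] (n - 1) = l\<close>.\<close>
    let ?w = "u \<otimes> \<alpha> \<otimes> \<alpha> [^] n"
    have w: "?w \<in> carrier R" "?w \<noteq> \<zero>"
      using u car(1) assms(2) pow0[of \<alpha> n] by (auto simp: integral_iff)
    \<comment> \<open>Positivity of \<open>n\<close> matters here, since the subtraction on naturals
      is truncated.\<close>
    have pow: "\<gamma> [^] n = u [^] (n - 1) \<otimes> u \<otimes> \<alpha> [^] n"
      unfolding \<gamma> using u(2) car(1) nat_pow_Suc[of u "n - 1"] assms(5)
      by (simp add: nat_pow_distrib)
    have "u [^] (n - 1) \<otimes> ?w = \<alpha> \<otimes> \<gamma> [^] n"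
      unfolding pow using u(2) car(1) by (simp add: m_ac)
    also have "\<dots> = l \<otimes> \<alpha> [^] n \<otimes> \<gamma>"
      by (rule eq_if_add_eq_zero[OF _ _ eq]) (use car in simp_all)
    also have "\<dots> = l \<otimes> ?w"
      unfolding \<gamma> using u(2) car(1,3) by (simp add: m_ac)
    finally have "u [^] (n - 1) = l"
      by (rule m_rcancel[THEN iffD1, OF w(2,1), rotated 2]) (use u(2) car(3) in auto)
    then have "l \<in> nonzero_powers R L (n - 1)"
      using u(1) unfolding nonzero_powers_def by blast
    then show False using l False by simp
  qed
qed

lemma B_no_zero_divisors:
  assumes L: "subfield L R" and leg: "legitimate R L s (p1, p2, p3, p4)"
    and p1: "p1 \<noteq> \<zero>" and lL: "l \<in> L"
    and l: "l = \<zero> \<or> l \<notin> nonzero_powers R L (2 ^ s - 1)"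
    and abcd: "a \<in> L" "b \<in> L" "c \<in> L" "d \<in> L"
    and fst0: "B_fst R s l (p1, p2, p3, p4) a b c d = \<zero>"
    and snd0: "a \<otimes> d \<oplus> b \<otimes> c = \<zero>"
  shows "a = \<zero> \<and> b = \<zero> \<or> c = \<zero> \<and> d = \<zero>"
proof (rule ccontr)
  assume contr: "\<not> ?thesis"
  note sub = subringE[OF subfieldE(1)[OF L]]
  have pL: "p1 \<in> L" "p2 \<in> L" "p3 \<in> L" "p4 \<in> L"
    using leg by (auto simp: legitimate_def)
  have car: "a \<in> carrier R" "b \<in> carrier R" "c \<in> carrier R" "d \<in> carrier R" "l \<in> carrier R"
    "p1 \<in> carrier R" "p2 \<in> carrier R" "p3 \<in> carrier R" "p4 \<in> carrier R"
    using abcd pL lL sub(1) by auto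
  have ad: "a \<otimes> d = b \<otimes> c"
    by (rule eq_if_add_eq_zero[OF _ _ snd0]) (use car in simp_all)
  have zero_pow: "\<zero> [^] ((2::nat) ^ s) = \<zero>"
    by (simp add: nat_pow_zero)
  have scalar: "\<alpha> \<otimes> \<gamma> [^] ((2::nat) ^ s) \<oplus> l \<otimes> \<alpha> [^] ((2::nat) ^ s) \<otimes> \<gamma> \<noteq> \<zero>"
    if "\<alpha> \<in> L - {\<zero>}" "\<gamma> \<in> L - {\<zero>}" for \<alpha> \<gamma>
    using scalar_factor_nonzero[OF L that lL _ l] by simp
  show False
  \<comment> \<open>The common direction of the two vectors is a point of the projective line. For
    \<open>b = \<zero>\<close> it is the point at infinity, represented by
    \<open>(\<one>, \<zero>)\<close>, where the form takes the value \<open>p1\<close>. Otherwise it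
    is represented by \<open>(e, \<one>)\<close> with \<open>e = a/b\<close>, the scalars are
    \<open>b\<close> and \<open>d\<close>, and the form takes the value of the polynomial at
    \<open>e\<close>.\<close>
  proof (cases "b = \<zero>")
    case True
    then have a: "a \<noteq> \<zero>" using contr by simp
    then have d: "d = \<zero>" using ad True car by (simp add: integral_iff)
    then have c: "c \<noteq> \<zero>" using contr by simp
    have "(a \<otimes> c [^] ((2::nat) ^ s) \<oplus> l \<otimes> a [^] ((2::nat) ^ s) \<otimes> c) \<otimes> p1 = \<zero>"
      using B_fst_proportional[of l p1 p2 p3 p4 a c \<one> \<zero> s] fst0 True d car
      by (simp add: zero_pow)
    then show False using scalar[of a c] a c p1 abcd car by (simp add: integral_iff)
  next
    case False
    define e where "e = a \<otimes> inv b"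
    have inv: "inv b \<in> L" "inv b \<otimes> b = \<one>"
      using subfield_m_inv[OF L, of b] abcd False by auto
    have invc: "inv b \<in> carrier R" using inv sub(1) by auto
    have e: "e \<in> L" "e \<in> carrier R" using abcd inv sub(1,6) by (auto simp: e_def)
    have ab: "a = b \<otimes> e"
    proof -
      have "b \<otimes> e = a \<otimes> (inv b \<otimes> b)" using car invc by (simp add: e_def m_ac)
      then show ?thesis using inv car by simp
    qed
    have cd: "c = d \<otimes> e"
    proof -
      have "b \<otimes> c = b \<otimes> (d \<otimes> e)" using ad ab car e by (simp add: m_ac)
      then show ?thesis using False car e m_lcancel by simp
    qed
    \<comment> \<open>If \<open>d\<close> vanished, so would \<open>c = d \<otimes> e\<close>, and
      the second factor would be zero.\<close>
    have d: "d \<noteq> \<zero>" using contr cd e by auto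
    have "(b \<otimes> d [^] ((2::nat) ^ s) \<oplus> l \<otimes> b [^] ((2::nat) ^ s) \<otimes> d) \<otimes> eval_p R s (p1, p2, p3, p4) e = \<zero>"
      using B_fst_proportional[of l p1 p2 p3 p4 b d e \<one> s] fst0 car e(2)
      by (simp add: ab[symmetric] cd[symmetric] eval_p_def m_ac)
    moreover have "eval_p R s (p1, p2, p3, p4) e \<in> carrier R"
      using car e(2) by (simp add: eval_p_def)
    moreover have "eval_p R s (p1, p2, p3, p4) e \<noteq> \<zero>"
      using leg e(1) by (simp add: legitimate_def)
    ultimately show False using scalar[of b d] False d abcd car by (simp add: integral_iff)
  qed
qed

section \<open>Verification of the presemifield axioms\<close>

lemma presemifield_B2:
  assumes L: "subfield L R" and z: "z \<in> carrier R" "z \<notin> L"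
    and fin: "finite (carrier R)" and ord: "order R = card L * card L"
    and leg: "legitimate R L s (p1, p2, p3, p4)"
    and p1: "p1 \<noteq> \<zero>" and lL: "l \<in> L"
    and l: "l = \<zero> \<or> l \<notin> nonzero_powers R L (2 ^ s - 1)"
  shows "presemifield (B2 R L z s l (p1, p2, p3, p4))"
proof -
  let ?t = "(p1, p2, p3, p4)"
  let ?f = "from_coords R z" and ?B = "B_mult R L z s l ?t"
  note sub = subringE[OF subfieldE(1)[OF L]]
  have car: "u \<in> carrier R" if "u \<in> L" for u using that sub(1) by auto
  have tL: "?t \<in> L \<times> L \<times> L \<times> L" using leg by (simp add: legitimate_def)
  have tcar: "?t \<in> carrier R \<times> carrier R \<times> carrier R \<times> carrier R" using tL car by auto
  have bij: "bij_betw ?f (L \<times> L) (carrier R)"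
    using bij_betw_from_coords[OF L z fin ord] .
  have coordsE: "\<exists>a b. a \<in> L \<and> b \<in> L \<and> x = ?f (a, b)" if "x \<in> carrier R" for x
    using that bij unfolding bij_betw_def by auto
  have inL: "B_fst R s l ?t a b c d \<in> L" "a \<otimes> d \<oplus> b \<otimes> c \<in> L"
    if "a \<in> L" "b \<in> L" "c \<in> L" "d \<in> L" for a b c d
    using that B_fst_in_subring[OF subfieldE(1)[OF L] lL tL] sub(6,7) by auto
  note mult = B_mult_from_coords[OF inj_on_from_coords[OF L z], of _ _ _ _ s l ?t]
  note add = from_coords_add[OF z(1) car car car car]
  have closed: "?B x y \<in> carrier R" if xy: "x \<in> carrier R" "y \<in> carrier R" for x y
  proof -
    obtain a b c d where *: "a \<in> L" "b \<in> L" "c \<in> L" "d \<in> L" "x = ?f (a, b)" "y = ?f (c, d)"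
      using coordsE xy by metis
    then show ?thesis
      using inL[OF *(1-4)] car z by (simp add: mult) (simp add: from_coords_def)
  qed
  have right: "?B (x \<oplus> y) w = ?B x w \<oplus> ?B y w"
    if xyw: "x \<in> carrier R" "y \<in> carrier R" "w \<in> carrier R" for x y w
  proof -
    obtain a b a' b' c d where *: "a \<in> L" "b \<in> L" "a' \<in> L" "b' \<in> L" "c \<in> L" "d \<in> L"
      "x = ?f (a, b)" "y = ?f (a', b')" "w = ?f (c, d)"
      using coordsE xyw by metis
    have "(a \<oplus> a') \<otimes> d \<oplus> (b \<oplus> b') \<otimes> c = (a \<otimes> d \<oplus> b \<otimes> c) \<oplus> (a' \<otimes> d \<oplus> b' \<otimes> c)"
      using * car by algebra
    then show ?thesis
      using * inL by (simp add: add mult sub(7) B_fst_add_left[OF car[OF lL] tcar] car)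
  qed
  have left: "?B w (x \<oplus> y) = ?B w x \<oplus> ?B w y"
    if xyw: "x \<in> carrier R" "y \<in> carrier R" "w \<in> carrier R" for x y w
  proof -
    obtain a b a' b' c d where *: "a \<in> L" "b \<in> L" "a' \<in> L" "b' \<in> L" "c \<in> L" "d \<in> L"
      "x = ?f (a, b)" "y = ?f (a', b')" "w = ?f (c, d)"
      using coordsE xyw by metis
    \<comment> \<open>Now \<open>w = (c, d)\<close> is the left factor, so its coordinates come
      first in the second component.\<close>
    have "c \<otimes> (b \<oplus> b') \<oplus> d \<otimes> (a \<oplus> a') = (c \<otimes> b \<oplus> d \<otimes> a) \<oplus> (c \<otimes> b' \<oplus> d \<otimes> a')"
      using * car by algebra
    then show ?thesis
      using * inL by (simp add: add mult sub(7) B_fst_add_right[OF car[OF lL] tcar] car)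
  qed
  have integral: "x = \<zero> \<or> y = \<zero>"
    if xy: "x \<in> carrier R" "y \<in> carrier R" "?B x y = \<zero>" for x y
  proof -
    obtain a b c d where *: "a \<in> L" "b \<in> L" "c \<in> L" "d \<in> L" "x = ?f (a, b)" "y = ?f (c, d)"
      using coordsE xy by metis
    have "B_fst R s l ?t a b c d = \<zero> \<and> a \<otimes> d \<oplus> b \<otimes> c = \<zero>"
      using xy(3) * mult inL by (intro from_coords_eq_zero[OF L z]) auto
    then have "a = \<zero> \<and> b = \<zero> \<or> c = \<zero> \<and> d = \<zero>"
      using B_no_zero_divisors[OF L leg p1 lL l *(1-4)] by simp
    then show ?thesis using * z by (auto simp: from_coords_def)
  qed
  \<comment> \<open>The axioms of an abelian group mention only the additive structure, which
    \<open>B2\<close> leaves unchanged.\<close>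
  have "abelian_group (B2 R L z s l ?t)"
    using abelian_group_axioms
    by (simp add: B2_def abelian_group_def abelian_group_axioms_def abelian_monoid_def)
  then show ?thesis
    using fin closed right left integral
    by (intro presemifield.intro presemifield_axioms.intro) (simp_all add: B2_def)
qed

end

theorem theorem3:
  fixes F :: "('a, 'b) ring_scheme" (structure)
    and L :: "'a set"
    and m s :: nat
    and \<mu> z l p1 p2 p3 p4 :: 'a
  assumes "m \<ge> 1"
    and "field F" and "order F = 2 ^ (2 * m)"
    and "subfield L F" and "card L = 2 ^ m"
    and "s < 2 * m"
    and "\<mu> \<in> L" and "abs_trace F m \<mu> = \<one>"
    and "z \<in> carrier F" and "z [^] (2::nat) \<oplus> z = \<mu>"
    and "legitimate F L s (p1, p2, p3, p4)"
    and "p1 \<noteq> \<zero>"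
    and "l \<in> L"
    and "l = \<zero> \<or> l \<in> (L - {\<zero>}) - nonzero_powers F L (2 ^ s - 1)"
  shows "presemifield (B2 F L z s l (p1, p2, p3, p4)) \<and>
         order (B2 F L z s l (p1, p2, p3, p4)) = 2 ^ (2 * m)"
proof -
  interpret char_two_field F
    using assms(2) field.char_two_if_order[OF assms(2,3)]
    by (simp add: char_two_field_def char_two_field_axioms_def)
  have "finite (carrier F)"
    using assms(3) unfolding order_def by (metis card.infinite power_not_zero zero_neq_numeral)
  moreover have "order F = card L * card L"
    using assms(3,5) by (simp add: power_add[symmetric] mult_2)
  \<comment> \<open>The trace condition on \<open>\<mu>\<close> enters here: it keeps
    \<open>z\<close> outside \<open>L\<close>, so that \<open>\<one>, z\<close> is a basis.\<close>
  moreover have "z \<notin> L"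
    using notin_subfield_if_abs_trace_one[OF assms(4,5)] assms(8,10) by simp
  ultimately have "presemifield (B2 F L z s l (p1, p2, p3, p4))"
    using assms(9,14) by (intro presemifield_B2 assms(4,11-13)) auto
  then show ?thesis
    using assms(3) by (simp add: B2_def order_def)
qed

end
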